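(* Let $\varphi$ and $\psi$ be analytic self-maps of $\mathbb{D}$ such that the composition operators $C_\varphi$ and $C_\psi$ are bounded on the Dirichlet space $\mathcal{D}$, and define $$\rho(z)=\left|\frac{\varphi(z)-\psi(z)}{1-\overline{\varphi(z)}\psi(z)}\right|,\qquad z\in\mathbb{D}.$$ If $C_\varphi-C_\psi$ is compact on $\mathcal{D}$, then $$\lim_{|z|\to1}\rho(z)\left(\frac{|\varphi'(z)|(1-|z|^2)}{1-|\varphi(z)|^2}+\frac{|\psi'(z)|(1-|z|^2)}{1-|\psi(z)|^2}\right)=0.$$
   Context: $\mathbb{D}=\{z\in\mathbb{C}:|z|<1\}$. For an analytic self-map $\varphi$ of $\mathbb{D}$, the composition operator is $C_\varphi f=f\circ\varphi$. The Dirichlet space $\mathcal{D}$ is the Hilbert space of analytic functions $f$ on $\mathbb{D}$ with $\|f\|_{\mathcal{D}}^2=|f(0)|^2+\int_{\mathbb{D}}|f'(z)|^2\,dA<\infty$, where $dA$ is Lebesgue area measure normalized so that $A(\mathbb{D})=1$. *)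

theory Defs
  imports "HOL-Probability.Probability" "HOL-Complex_Analysis.Complex_Analysis"
begin

abbreviation unit_disc :: "complex set" where
  "unit_disc \<equiv> ball 0 1"

definition analytic_self_map :: "(complex \<Rightarrow> complex) \<Rightarrow> bool" where
  "analytic_self_map \<phi> \<longleftrightarrow> \<phi> holomorphic_on unit_disc \<and> \<phi> ` unit_disc \<subseteq> unit_disc"

text \<open>The measure lives on the disc only (not on the whole plane), so that values of a function
  outside the disc cannot affect measurability or integrability.\<close>

definition disc_area :: "complex measure" where
  "disc_area = uniform_measure (restrict_space lborel unit_disc) unit_disc"

lemma emeasure_disc_area: "emeasure disc_area unit_disc = 1"
proof -
  have sets: "unit_disc \<in> sets (restrict_space lborel unit_disc)"
    by (simp add: sets_restrict_space_iff)
  have eq: "emeasure (restrict_space lborel unit_disc) unit_disc = emeasure lborel unit_disc"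
    by (simp add: emeasure_restrict_space)
  have pos: "emeasure lborel unit_disc \<noteq> 0"
    by (simp add: emeasure_ball unit_ball_vol_pos less_imp_neq[symmetric])
  have fin: "emeasure lborel unit_disc \<noteq> \<infinity>"
    using emeasure_lborel_ball_finite[of "0::complex" 1] by simp
  show ?thesis
    unfolding disc_area_def
    using emeasure_uniform_measure_1[OF _ ] sets eq pos fin
    by (metis emeasure_uniform_measure Int_absorb ennreal_divide_self infinity_ennreal_def less_top)
qed

text \<open>An analytic function on the disc is represented by a total function on the complex plane of
  which only the restriction to the disc matters. Two representatives of the same function
  differ by a function of norm 0.\<close>

definition dirichlet_space :: "(complex \<Rightarrow> complex) set" where
  "dirichlet_space =
     {f. f holomorphic_on unit_disc \<and> integrable disc_area (\<lambda>z. (cmod (deriv f z))\<^sup>2)}"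

definition dirichlet_norm :: "(complex \<Rightarrow> complex) \<Rightarrow> real" where
  "dirichlet_norm f = sqrt ((cmod (f 0))\<^sup>2 + (LINT z|disc_area. (cmod (deriv f z))\<^sup>2))"

definition composition_operator ::
    "(complex \<Rightarrow> complex) \<Rightarrow> (complex \<Rightarrow> complex) \<Rightarrow> (complex \<Rightarrow> complex)" where
  "composition_operator \<phi> f = f \<circ> \<phi>"

text \<open>The following two notions are meant for linear maps; composition operators and their
  differences are linear by construction.\<close>

definition bounded_on_dirichlet ::
    "((complex \<Rightarrow> complex) \<Rightarrow> (complex \<Rightarrow> complex)) \<Rightarrow> bool" where
  "bounded_on_dirichlet T \<longleftrightarrow>
     (\<forall>f\<in>dirichlet_space. T f \<in> dirichlet_space) \<and>
     (\<exists>C. \<forall>f\<in>dirichlet_space. dirichlet_norm (T f) \<le> C * dirichlet_norm f)"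

text \<open>Compactness of an operator: the images of every norm-bounded sequence have a subsequence
  that converges in norm to an element of the space.\<close>

definition compact_on_dirichlet ::
    "((complex \<Rightarrow> complex) \<Rightarrow> (complex \<Rightarrow> complex)) \<Rightarrow> bool" where
  "compact_on_dirichlet T \<longleftrightarrow>
     (\<forall>f\<in>dirichlet_space. T f \<in> dirichlet_space) \<and>
     (\<forall>F :: nat \<Rightarrow> complex \<Rightarrow> complex.
        (\<forall>n. F n \<in> dirichlet_space) \<and> (\<exists>B. \<forall>n. dirichlet_norm (F n) \<le> B) \<longrightarrow>
        (\<exists>r g. strict_mono (r :: nat \<Rightarrow> nat) \<and> g \<in> dirichlet_space \<and>
           (\<lambda>n. dirichlet_norm (T (F (r n)) - g)) \<longlonglongrightarrow> 0))"

definition pseudohyp_dist ::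
    "(complex \<Rightarrow> complex) \<Rightarrow> (complex \<Rightarrow> complex) \<Rightarrow> complex \<Rightarrow> real" where
  "pseudohyp_dist \<phi> \<psi> z = cmod ((\<phi> z - \<psi> z) / (1 - cnj (\<phi> z) * \<psi> z))"

text \<open>The limit over points of the disc whose modulus tends to 1: for the left-sided filter at 1,
  only points of modulus less than 1 are considered.\<close>

abbreviation to_unit_circle :: "complex filter" where
  "to_unit_circle \<equiv> filtercomap cmod (at_left 1)"

end

theory Submission
  imports Defs
begin

text \<open>
  By the area mean value property, \<open>(1 - |z|\<^sup>2) |h' z|\<close> is at most a constant times the norm of a
  function \<open>h\<close> in the Dirichlet space, and it tends to 0 as \<open>|z| \<rightarrow> 1\<close> for each fixed \<open>h\<close>. Hence, if \<open>T\<close>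
  is compact and the functions \<open>F\<^sub>z\<close> are bounded in norm, then \<open>(1 - |z|\<^sup>2) |(T F\<^sub>z)' z| \<rightarrow> 0\<close> as
  \<open>|z| \<rightarrow> 1\<close>. Let \<open>A\<close> and \<open>B\<close> be the two hyperbolic derivatives in the statement. With \<open>F\<^sub>z\<close> the disc
  automorphism vanishing at \<open>\<phi> z\<close> this gives \<open>A \<le> (1 - \<rho>\<^sup>2) B + o(1)\<close>, and with its square it gives
  \<open>\<rho> (1 - \<rho>\<^sup>2) B \<rightarrow> 0\<close>; together, \<open>\<rho> A \<rightarrow> 0\<close>. By symmetry \<open>\<rho> B \<rightarrow> 0\<close>.
\<close>

subsection \<open>Area mean values\<close>

text \<open>Uniqueness of Haar measure by Fubini: for the unit ball \<open>B\<close>, integrating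
  \<open>1\<^sub>A(f x) 1\<^sub>B(y - f x)\<close> in the two possible orders gives \<open>vol (f\<^sup>-\<^sup>1 A) * vol B\<close> and
  \<open>vol A * vol B\<close>.\<close>

lemma lborel_distr_orthogonal:
  fixes f :: "'a::euclidean_space \<Rightarrow> 'a"
  assumes f: "orthogonal_transformation f"
  shows "distr lborel borel f = lborel"
proof (rule measure_eqI)
  show "sets (distr lborel borel f) = sets (lborel :: 'a measure)"
    by simp
next
  fix A :: "'a set"
  assume "A \<in> sets (distr lborel borel f)"
  then have A [measurable]: "A \<in> sets borel"
    by simp
  have lin: "linear f" and nf: "\<And>x. norm (f x) = norm x"
    using f orthogonal_transformation by auto
  have f_borel [measurable]: "f \<in> borel_measurable borel"
    using lin by (intro borel_measurable_continuous_onI linear_continuous_on linear_conv_bounded_linear[THEN iffD1])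
  have B [measurable]: "ball (0::'a) 1 \<in> sets borel"
    by simp
  let ?B = "ball (0::'a) 1"
  let ?v = "emeasure lborel ?B"
  have v: "?v \<noteq> 0" "?v \<noteq> \<infinity>"
    using emeasure_lborel_ball_finite[of "0::'a" 1]
    by (auto simp: emeasure_ball unit_ball_vol_pos less_imp_neq[symmetric])
  have shift: "(\<integral>\<^sup>+x. g (c + x) \<partial>lborel) = (\<integral>\<^sup>+x. g x \<partial>lborel)"
    if [measurable]: "g \<in> borel_measurable borel" for g :: "'a \<Rightarrow> ennreal" and c
    by (subst (2) lborel_distr_plus[of c, symmetric]) (simp add: nn_integral_distr)
  let ?J = "\<integral>\<^sup>+x. (\<integral>\<^sup>+y. indicator A (f x) * indicator ?B (y - f x) \<partial>lborel) \<partial>lborel"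
  have "?J = (\<integral>\<^sup>+x. indicator A (f x) * (\<integral>\<^sup>+y. indicator ?B (y - f x) \<partial>lborel) \<partial>lborel)"
    by (intro nn_integral_cong nn_integral_cmult) simp
  also have "\<dots> = (\<integral>\<^sup>+x. indicator A (f x) * ?v \<partial>lborel)"
    using shift[of "\<lambda>y. indicator ?B (y - f x)" "f x" for x] by (simp add: algebra_simps)
  also have "\<dots> = emeasure (distr lborel borel f) A * ?v"
    by (simp add: nn_integral_multc nn_integral_distr flip: nn_integral_indicator)
  finally have J1: "?J = emeasure (distr lborel borel f) A * ?v" .
  have "?J = (\<integral>\<^sup>+y. (\<integral>\<^sup>+x. indicator A (f x) * indicator ?B (y - f x) \<partial>lborel) \<partial>lborel)"
    by (rule lborel_pair.Fubini') measurable
  also have "\<dots> = (\<integral>\<^sup>+y. (\<integral>\<^sup>+x. indicator A (f x + y) * indicator ?B x \<partial>lborel) \<partial>lborel)"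
  proof (rule nn_integral_cong)
    fix y :: 'a
    \<comment> \<open>Translating \<open>x\<close> by a preimage \<open>c\<close> of
      \<open>y\<close> turns the argument \<open>y - f x\<close> of the ball's indicator into
      \<open>- f x\<close>. Since \<open>f\<close> preserves norms, that indicator no longer depends
      on \<open>f\<close>, and \<open>y\<close> survives only inside \<open>A\<close>, where the
      next exchange of integrals removes it by translation.\<close>
    obtain c where c: "f c = y"
      using orthogonal_transformation_surj[OF f] by (metis surjD)
    have "f (c + x) = f x + y" for x
      using c lin by (simp add: linear_add)
    moreover have "y - f (c + x) = - f x" for x
      using c lin by (simp add: linear_add)
    moreover have "indicator ?B (- f x) = (indicator ?B x :: ennreal)" for x
      by (simp add: indicator_def nf)
    ultimately show "(\<integral>\<^sup>+x. indicator A (f x) * indicator ?B (y - f x) \<partial>lborel) =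
        (\<integral>\<^sup>+x. indicator A (f x + y) * indicator ?B x \<partial>lborel)"
      using shift[of "\<lambda>x. indicator A (f x) * indicator ?B (y - f x)" c] by simp
  qed
  also have "\<dots> = (\<integral>\<^sup>+x. (\<integral>\<^sup>+y. indicator A (f x + y) * indicator ?B x \<partial>lborel) \<partial>lborel)"
    by (rule lborel_pair.Fubini') measurable
  also have "\<dots> = (\<integral>\<^sup>+x. emeasure lborel A * indicator ?B x \<partial>lborel)"
    using shift[of "indicator A" "f x" for x] by (simp add: nn_integral_multc)
  also have "\<dots> = emeasure lborel A * ?v"
    by (simp add: nn_integral_cmult)
  finally show "emeasure (distr lborel borel f) A = emeasure lborel A"
    using J1 v by (metis ennreal_mult_divide_eq infinity_ennreal_def)
qed

text \<open>Rotation by the angle \<open>pi / k\<close> preserves Lebesgue measure and the ball, but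
  multiplies \<open>w ^ k\<close> by \<open>cis pi = -1\<close>. So the integral equals its own
  negative.\<close>

lemma integral_power_ball_eq_0:
  assumes "k > 0"
  shows "(LINT w|lborel. indicator (ball 0 r) w *\<^sub>R (w::complex) ^ k) = 0"
proof -
  let ?c = "cis (pi / k)"
  let ?f = "\<lambda>w::complex. indicator (ball 0 r) w *\<^sub>R w ^ k"
  have "orthogonal_transformation ((*) ?c)"
    by (simp add: orthogonal_transformation norm_mult linear_times)
  then have "(LINT w|lborel. ?f w) = (LINT w|distr lborel borel ((*) ?c). ?f w)"
    by (simp add: lborel_distr_orthogonal)
  also have "\<dots> = (LINT w|lborel. ?f (?c * w))"
    by (rule integral_distr) (auto intro!: borel_measurable_scaleR borel_measurable_power borel_measurable_indicator)
  also have "\<dots> = (LINT w|lborel. - ?f w)"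
    using assms by (intro Bochner_Integration.integral_cong)
      (auto simp: indicator_def norm_mult power_mult_distrib Complex.DeMoivre)
  finally show ?thesis
    by simp
qed

lemma area_mean_value:
  assumes h: "h holomorphic_on ball z R" and r: "0 < r" "r < R"
  shows "(LINT w|lborel. indicator (ball z r) w *\<^sub>R h w) = of_real (pi * r\<^sup>2) * h z"
proof -
  \<comment> \<open>Integrate the Taylor series term by term; only the constant term survives.\<close>
  define a where "a k = (deriv ^^ k) h z / fact k" for k
  define F where "F k w = indicator (ball 0 r) w *\<^sub>R (a k * w ^ k)" for k and w :: complex
  have a: "(\<lambda>k. a k * w ^ k) sums h (z + w)" if "norm w < R" for w
    using holomorphic_power_series[OF h, of "z + w"] that by (simp add: a_def dist_norm)
  \<comment> \<open>The series converges at the radius \<open>(r + R) / 2\<close>, which lies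
    strictly between \<open>r\<close> and \<open>R\<close>, hence absolutely at \<open>r\<close>.
    This one numerical series dominates all terms on the ball and justifies exchanging sum and
    integral.\<close>
  have summ: "summable (\<lambda>k. norm (a k) * r ^ k)"
  proof -
    have "summable (\<lambda>k. norm (a k * complex_of_real r ^ k))"
    proof (rule powser_insidea)
      show "summable (\<lambda>k. a k * complex_of_real ((r + R) / 2) ^ k)"
        using r by (intro sums_summable[OF a]) (simp flip: of_real_add)
      show "norm (complex_of_real r) < norm (complex_of_real ((r + R) / 2))"
        using r by (simp flip: of_real_add)
    qed
    then show ?thesis
      using r by (simp add: norm_mult norm_power)
  qed
  have F_le: "norm (F k w) \<le> indicator (ball 0 r) w * (norm (a k) * r ^ k)" for k w
    using r by (auto simp: F_def norm_mult norm_power indicator_def intro!: mult_left_mono power_mono)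
  have F_meas [measurable]: "F k \<in> borel_measurable borel" for k
    unfolding F_def by (intro borel_measurable_continuous_on_indicator continuous_intros) auto
  have ind: "integrable lborel (\<lambda>w::complex. indicator (ball 0 r) w * c)" for c :: real
    using emeasure_lborel_ball_finite[of "0::complex" r]
    by (intro integrable_mult_left integrable_real_indicator) auto
  have F_int: "integrable lborel (F k)" for k
    by (rule Bochner_Integration.integrable_bound[OF ind[of "norm (a k) * r ^ k"]])
      (use F_le r in auto)
  have "(\<lambda>k. LINT w|lborel. F k w) sums (LINT w|lborel. (\<Sum>k. F k w))"
  proof (rule sums_integral[OF F_int])
    have "summable (\<lambda>k. norm (F k w))" for w
      by (rule summable_comparison_test[OF _ summable_mult[OF summ, of "indicator (ball 0 r) w"]])
        (use F_le in auto)
    then show "AE w in lborel. summable (\<lambda>k. norm (F k w))"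
      by simp
    have "norm (LINT w|lborel. norm (F k w)) \<le>
        measure lborel (ball (0::complex) r) * (norm (a k) * r ^ k)" for k
      using integral_mono[OF integrable_norm[OF F_int] ind F_le, of k] by simp
    then show "summable (\<lambda>k. LINT w|lborel. norm (F k w))"
      by (intro summable_comparison_test[OF _ summable_mult[OF summ]]) auto
  qed
  moreover have "(\<Sum>k. F k w) = indicator (ball z r) (z + w) *\<^sub>R h (z + w)" for w
    using sums_unique[OF a[of w]] r by (auto simp: F_def indicator_def dist_norm)
  moreover have "(LINT w|lborel. F k w) = 0" if "k > 0" for k
  proof -
    have "F k = (\<lambda>w. a k * (indicator (ball 0 r) w *\<^sub>R w ^ k))"
      by (simp add: F_def fun_eq_iff)
    then show ?thesis
      using integral_power_ball_eq_0[OF that, of r]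
      by (simp only: integral_mult_right_zero mult_zero_right)
  qed
  then have "(\<lambda>k. LINT w|lborel. F k w) sums (LINT w|lborel. F 0 w)"
    using sums_single[of 0 "\<lambda>k. LINT w|lborel. F k w"]
    by (elim back_subst[of "\<lambda>f. f sums _"]) (auto simp: fun_eq_iff)
  ultimately have "(LINT w|lborel. F 0 w) =
      (LINT w|lborel. indicator (ball z r) (z + w) *\<^sub>R h (z + w))"
    using sums_unique2 by fastforce
  also have "\<dots> = (LINT w|distr lborel borel ((+) z). indicator (ball z r) w *\<^sub>R h w)"
    using r by (intro integral_distr[symmetric] borel_measurable_continuous_on_indicator
      holomorphic_on_imp_continuous_on holomorphic_on_subset[OF h]) auto
  also have "\<dots> = (LINT w|lborel. indicator (ball z r) w *\<^sub>R h w)"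
    by (simp add: lborel_distr_plus)
  finally show ?thesis
    using r emeasure_lborel_ball_finite[of "0::complex" r]
    by (simp add: F_def a_def content_ball unit_ball_vol_2 scaleR_conv_of_real)
qed

text \<open>The mean value property is applied to the holomorphic function \<open>g\<^sup>2\<close>,
  whose modulus is the square of that of \<open>g\<close>; the integral triangle inequality does the
  rest.\<close>

lemma area_submean_value:
  assumes g: "g holomorphic_on ball z R" and r: "0 < r" "r < R"
  shows "pi * r\<^sup>2 * (cmod (g z))\<^sup>2 \<le> (LINT w|lborel. indicator (ball z r) w * (cmod (g w))\<^sup>2)"
proof -
  have "pi * r\<^sup>2 * (cmod (g z))\<^sup>2 = cmod (of_real (pi * r\<^sup>2) * (g z)\<^sup>2)"
    by (simp add: norm_mult norm_power)
  also have "\<dots> = cmod (LINT w|lborel. indicator (ball z r) w *\<^sub>R (g w)\<^sup>2)"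
    using area_mean_value[of "\<lambda>w. (g w)\<^sup>2" z R r] g r by (simp add: holomorphic_on_power)
  also have "\<dots> \<le> (LINT w|lborel. cmod (indicator (ball z r) w *\<^sub>R (g w)\<^sup>2))"
    by (rule integral_norm_bound)
  finally show ?thesis
    by (simp add: norm_power)
qed

section \<open>Passing between normalized area measure and Lebesgue measure\<close>

lemma disc_area_eq_density:
  "disc_area = density (restrict_space lborel unit_disc) (\<lambda>_. ennreal (1 / pi))"
  unfolding disc_area_def uniform_measure_def
proof (rule density_cong)
  have "emeasure (restrict_space lborel unit_disc) unit_disc = ennreal pi"
    by (simp add: emeasure_restrict_space emeasure_ball unit_ball_vol_2)
  then show "AE x in restrict_space lborel unit_disc. indicator unit_disc x /
      emeasure (restrict_space lborel unit_disc) unit_disc = ennreal (1 / pi)"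
    by (auto simp: space_restrict_space divide_ennreal simp flip: ennreal_1)
  show "(\<lambda>x. indicator unit_disc x / emeasure (restrict_space lborel unit_disc) unit_disc)
      \<in> borel_measurable (restrict_space lborel unit_disc)"
    by (intro borel_measurable_divide_ennreal borel_measurable_indicator) (auto simp: sets_restrict_space_iff)
qed auto

lemma measurable_disc_area:
  fixes f :: "complex \<Rightarrow> real"
  assumes "continuous_on unit_disc f"
  shows "f \<in> borel_measurable (restrict_space lborel unit_disc)"
  using borel_measurable_continuous_on_restrict[OF assms]
  by (simp cong: measurable_cong_sets sets_restrict_space_cong)

text \<open>Continuity on the disc supplies measurability for the restricted measure, and the
  indicator discards whatever values \<open>f\<close> takes elsewhere. All later estimates are made
  on the Lebesgue side.\<close>

lemma
  fixes f :: "complex \<Rightarrow> real"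
  assumes f: "continuous_on unit_disc f"
  shows integrable_disc_area_iff:
      "integrable disc_area f \<longleftrightarrow> integrable lborel (\<lambda>w. indicator unit_disc w * f w)"
    and integral_disc_area_eq:
      "(LINT w|disc_area. f w) = (LINT w|lborel. indicator unit_disc w * f w) / pi"
  unfolding disc_area_eq_density
  using measurable_disc_area[OF f]
  by (simp_all add: integrable_density integral_density integrable_restrict_space
      integral_restrict_space divide_inverse)

subsection \<open>The Dirichlet integral of a disc automorphism\<close>

text \<open>Polar coordinates would give the sharp value \<open>pi / \<delta>\<^sup>2\<close>;
  dyadic annuli lose only a constant. What matters is the power of \<delta>, which later cancels
  against a factor \<open>\<delta>\<^sup>2\<close>.\<close>

lemma nn_integral_norm_power4_le:
  fixes p :: complex
  assumes \<delta>: "\<delta> > 0"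
  shows "(\<integral>\<^sup>+v. indicator (- ball p \<delta>) v * ennreal (1 / cmod (v - p) ^ 4) \<partial>lborel)
    \<le> ennreal (16 * pi / (3 * \<delta>\<^sup>2))"
proof -
  \<comment> \<open>Dominate the integrand on the dyadic annulus with radii \<open>2 ^ k * \<delta>\<close> and
    \<open>2 ^ Suc k * \<delta>\<close> by its value on the inner circle.\<close>
  define c where "c k = 1 / (2 ^ k * \<delta>) ^ 4" for k :: nat
  define B where "B k = ball p (2 ^ Suc k * \<delta>)" for k :: nat
  have c: "c k \<ge> 0" for k
    using \<delta> by (simp add: c_def)
  have pointwise: "indicator (- ball p \<delta>) v * ennreal (1 / cmod (v - p) ^ 4)
      \<le> (\<Sum>k. ennreal (c k) * indicator (B k) v)" for v
  proof (cases "v \<in> ball p \<delta>")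
    case False
    \<comment> \<open>The least \<open>n\<close> locates the annulus containing \<open>v\<close>. It
      is positive because \<open>v\<close> is at distance at least \<delta> from \<open>p\<close>,
      so its predecessor \<open>k\<close> exists and gives the inner radius.\<close>
    define n where "n = (LEAST n. cmod (v - p) / \<delta> < 2 ^ n)"
    obtain n0 where "cmod (v - p) / \<delta> < 2 ^ n0"
      using real_arch_pow[of 2] by auto
    then have n: "cmod (v - p) / \<delta> < 2 ^ n"
      unfolding n_def by (rule LeastI)
    have ge: "\<delta> \<le> cmod (v - p)"
      using False by (simp add: dist_norm norm_minus_commute)
    with n \<delta> have "n \<noteq> 0"
      by (intro notI) simp
    then obtain k where k: "n = Suc k"
      using not0_implies_Suc by blast
    have "\<not> cmod (v - p) / \<delta> < 2 ^ k"
      by (rule not_less_Least) (simp flip: n_def add: k)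
    then have low: "2 ^ k * \<delta> \<le> cmod (v - p)"
      using \<delta> by (simp add: field_simps)
    have "v \<in> B k"
      using n \<delta> by (simp add: B_def dist_norm norm_minus_commute k field_simps)
    moreover have "1 / cmod (v - p) ^ 4 \<le> c k"
      unfolding c_def using low \<delta> ge
      by (intro divide_left_mono power_mono mult_pos_pos zero_less_power) (auto intro: less_le_trans)
    ultimately have "indicator (- ball p \<delta>) v * ennreal (1 / cmod (v - p) ^ 4)
        \<le> ennreal (c k) * indicator (B k) v"
      by (auto simp: indicator_def intro: ennreal_leI)
    also have "\<dots> \<le> (\<Sum>k. ennreal (c k) * indicator (B k) v)"
      using sum_le_suminf[of f "{k}" for f :: "nat \<Rightarrow> ennreal", simplified] .
    finally show ?thesis .
  qed auto
  have "(\<integral>\<^sup>+v. indicator (- ball p \<delta>) v * ennreal (1 / cmod (v - p) ^ 4) \<partial>lborel)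
      \<le> (\<integral>\<^sup>+v. (\<Sum>k. ennreal (c k) * indicator (B k) v) \<partial>lborel)"
    by (intro nn_integral_mono pointwise)
  also have "\<dots> = (\<Sum>k. \<integral>\<^sup>+v. ennreal (c k) * indicator (B k) v \<partial>lborel)"
    by (rule nn_integral_suminf)
      (auto simp: B_def intro!: borel_measurable_times_ennreal borel_measurable_indicator)
  \<comment> \<open>The area of \<open>B k\<close> grows like \<open>4 ^ k\<close> while
    \<open>c k\<close> decays like \<open>(1 / 16) ^ k\<close>, which leaves a geometric series of
    ratio \<open>1 / 4\<close> and sum \<open>4 / 3\<close>.\<close>
  also have "\<dots> = (\<Sum>k. ennreal (4 * pi / \<delta>\<^sup>2 * (1 / 4) ^ k))"
  proof (rule suminf_cong)
    fix k
    have "(\<integral>\<^sup>+v. ennreal (c k) * indicator (B k) v \<partial>lborel) = ennreal (c k) * emeasure lborel (B k)"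
      by (simp add: B_def nn_integral_cmult_indicator)
    also have "\<dots> = ennreal (c k * (pi * (2 ^ Suc k * \<delta>)\<^sup>2))"
      using \<delta> c by (simp add: B_def emeasure_ball unit_ball_vol_2 ennreal_mult)
    also have "c k * (pi * (2 ^ Suc k * \<delta>)\<^sup>2) = 4 * pi / \<delta>\<^sup>2 * (1 / 2 ^ k)\<^sup>2"
      unfolding c_def using \<delta> by (simp add: field_simps eval_nat_numeral)
    also have "(1 / 2 ^ k)\<^sup>2 = ((1 / 4) ^ k :: real)"
      by (simp add: power2_eq_square power_divide flip: power_mult_distrib)
    finally show "(\<integral>\<^sup>+v. ennreal (c k) * indicator (B k) v \<partial>lborel) = ennreal (4 * pi / \<delta>\<^sup>2 * (1 / 4) ^ k)" .
  qed
  also have "\<dots> = ennreal (\<Sum>k. 4 * pi / \<delta>\<^sup>2 * (1 / 4) ^ k)"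
    by (intro suminf_ennreal2 summable_mult summable_geometric) auto
  also have "(\<Sum>k. 4 * pi / \<delta>\<^sup>2 * (1 / 4) ^ k) = 16 * pi / (3 * \<delta>\<^sup>2)"
    by (subst suminf_mult) (auto simp: suminf_geometric summable_geometric)
  finally show ?thesis .
qed

section \<open>Derivatives of disc automorphisms\<close>

lemma one_minus_cnj_mult_nonzero:
  assumes "cmod a < 1" "cmod w < 1"
  shows "1 - cnj a * w \<noteq> 0"
proof
  assume "1 - cnj a * w = 0"
  then have "cmod (cnj a * w) = 1"
    by (metis norm_one eq_iff_diff_eq_0)
  moreover have "cmod a * cmod w < 1 * 1"
    using assms by (intro mult_strict_mono') auto
  ultimately show False
    by (simp add: norm_mult)
qed

lemma has_field_derivative_Moebius_function:
  assumes "cmod a < 1" "cmod w < 1"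
  shows "(Moebius_function 0 a has_field_derivative
    (1 - (cmod a)\<^sup>2) / (1 - cnj a * w)\<^sup>2) (at w)"
proof -
  have 1: "Moebius_function 0 a = (\<lambda>z. (z - a) / (1 - cnj a * z))"
    by (simp add: Moebius_function_simple fun_eq_iff)
  have "complex_of_real ((cmod a)\<^sup>2) = a * cnj a"
    by (rule complex_norm_square)
  then show ?thesis
    unfolding 1 using one_minus_cnj_mult_nonzero[OF assms]
    by (auto intro!: derivative_eq_intros simp: field_simps power2_eq_square)
qed

text \<open>The integral is the area of the image of the disc under an automorphism, so its exact
  value is \<open>pi\<close>. A bound uniform in \<open>a\<close> is enough, and it follows without
  a change of variables: for small \<open>a\<close> the denominator stays away from 0, and otherwise
  the integrand is compared with the fourth power of the distance to the pole.\<close>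

lemma nn_integral_deriv_Moebius_le:
  assumes a: "cmod a < 1"
  shows "(\<integral>\<^sup>+w. indicator unit_disc w *
    ennreal ((cmod ((1 - (cmod a)\<^sup>2) / (1 - cnj a * w)\<^sup>2))\<^sup>2) \<partial>lborel) \<le> ennreal (48 * pi)"
    (is "?I \<le> _")
proof -
  have a2: "0 \<le> 1 - (cmod a)\<^sup>2" "1 - (cmod a)\<^sup>2 \<le> 1"
    using a by (auto simp: power_le_one)
  have sq: "(cmod ((1 - (cmod a)\<^sup>2) / (1 - cnj a * w)\<^sup>2))\<^sup>2 =
      (1 - (cmod a)\<^sup>2)\<^sup>2 / cmod (1 - cnj a * w) ^ 4" for w
  proof -
    have "cmod (1 - complex_of_real ((cmod a)\<^sup>2)) = 1 - (cmod a)\<^sup>2"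
      using a2 by (metis abs_of_nonneg norm_of_real of_real_1 of_real_diff)
    then show ?thesis
      by (simp add: norm_divide norm_power power_divide flip: power_mult)
  qed
  show ?thesis
  proof (cases "cmod a \<le> 1 / 2")
    case True
    have "(cmod ((1 - (cmod a)\<^sup>2) / (1 - cnj a * w)\<^sup>2))\<^sup>2 \<le> 16" if "cmod w < 1" for w
    proof -
      have "cmod (cnj a * w) \<le> 1 / 2 * 1"
        unfolding norm_mult using True that by (intro mult_mono) auto
      then have "1 / 2 \<le> cmod (1 - cnj a * w)"
        using norm_triangle_ineq2[of 1 "cnj a * w"] by simp
      then have "(1 / 2) ^ 4 \<le> cmod (1 - cnj a * w) ^ 4"
        by (intro power_mono) auto
      moreover have "(1 - (cmod a)\<^sup>2)\<^sup>2 \<le> 1"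
        using a2 by (simp add: power_le_one)
      ultimately have "(1 - (cmod a)\<^sup>2)\<^sup>2 / cmod (1 - cnj a * w) ^ 4 \<le> 1 / (1 / 2) ^ 4"
        by (intro frac_le) auto
      then show ?thesis
        unfolding sq by (simp add: power_divide)
    qed
    from ennreal_leI[OF this] have "?I \<le> (\<integral>\<^sup>+w. ennreal 16 * indicator (ball (0::complex) 1) w \<partial>lborel)"
      by (intro nn_integral_mono) (simp add: indicator_def del: of_real_diff)
    also have "\<dots> = ennreal (16 * pi)"
      by (simp add: nn_integral_cmult_indicator emeasure_ball unit_ball_vol_2 ennreal_mult)
    also have "\<dots> \<le> ennreal (48 * pi)"
      by (intro ennreal_leI) simp
    finally show ?thesis .
  next
    case False
    \<comment> \<open>The reflected point \<open>1 / cnj a\<close> is the pole, at distance \<open>\<delta>\<close> from the disc.\<close>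
    define p where "p = 1 / cnj a"
    define \<delta> where "\<delta> = 1 / cmod a - 1"
    have a0: "a \<noteq> 0" "cmod a > 0"
      using False by auto
    have \<delta>: "\<delta> > 0"
      using a a0 by (simp add: \<delta>_def)
    \<comment> \<open>The quotient factors as \<open>(1 / cmod a - 1) * (1 / cmod a + 1)\<close>.
      The first factor is \<delta>, and the second is at most 3 because
      \<open>cmod a > 1 / 2\<close>. Its square yields the 9 in
      \<open>9 * 16 / 3 = 48\<close>.\<close>
    have s: "(1 - (cmod a)\<^sup>2) / (cmod a)\<^sup>2 \<le> 3 * \<delta>"
    proof -
      have "1 / cmod a + 1 \<le> 3"
        using False a0 by (simp add: field_simps)
      then have "\<delta> * (1 / cmod a + 1) \<le> \<delta> * 3"
        using \<delta> by (intro mult_left_mono) auto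
      moreover have "(1 - (cmod a)\<^sup>2) / (cmod a)\<^sup>2 = \<delta> * (1 / cmod a + 1)"
        using a0 by (simp add: \<delta>_def field_simps power2_eq_square)
      ultimately show ?thesis
        by simp
    qed
    have "indicator unit_disc w * ennreal ((cmod ((1 - (cmod a)\<^sup>2) / (1 - cnj a * w)\<^sup>2))\<^sup>2)
        \<le> ennreal (9 * \<delta>\<^sup>2) * (indicator (- ball p \<delta>) w * ennreal (1 / cmod (w - p) ^ 4))" for w
    proof (cases "cmod w < 1")
      case True
      have "cmod (w - p) \<ge> \<delta>"
        using norm_triangle_ineq2[of p w] True by (simp add: p_def \<delta>_def norm_divide norm_minus_commute)
      moreover have "(cmod ((1 - (cmod a)\<^sup>2) / (1 - cnj a * w)\<^sup>2))\<^sup>2 \<le> 9 * \<delta>\<^sup>2 * (1 / cmod (w - p) ^ 4)"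
      proof -
        have "1 - cnj a * w = - (cnj a * (w - p))"
          using a0 by (simp add: p_def field_simps)
        then have "cmod (1 - cnj a * w) = cmod a * cmod (w - p)"
          by (simp add: norm_mult)
        then have "(1 - (cmod a)\<^sup>2)\<^sup>2 / cmod (1 - cnj a * w) ^ 4 =
            ((1 - (cmod a)\<^sup>2) / (cmod a)\<^sup>2)\<^sup>2 * (1 / cmod (w - p) ^ 4)"
          by (simp add: power_mult_distrib power_divide flip: power_mult)
        also have "\<dots> \<le> (3 * \<delta>)\<^sup>2 * (1 / cmod (w - p) ^ 4)"
          using s a2 by (intro mult_right_mono power_mono) auto
        finally show ?thesis
          unfolding sq by (simp add: power_mult_distrib)
      qed
      ultimately show ?thesis
        using True by (auto simp: indicator_def dist_norm norm_minus_commute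
            ennreal_mult[symmetric] intro!: ennreal_leI)
    qed (auto simp: indicator_def)
    then have "?I \<le> (\<integral>\<^sup>+w. ennreal (9 * \<delta>\<^sup>2) *
        (indicator (- ball p \<delta>) w * ennreal (1 / cmod (w - p) ^ 4)) \<partial>lborel)"
      by (intro nn_integral_mono)
    also have "\<dots> = ennreal (9 * \<delta>\<^sup>2) *
        (\<integral>\<^sup>+w. indicator (- ball p \<delta>) w * ennreal (1 / cmod (w - p) ^ 4) \<partial>lborel)"
      by (rule nn_integral_cmult) (auto intro!: borel_measurable_indicator)
    also have "\<dots> \<le> ennreal (9 * \<delta>\<^sup>2) * ennreal (16 * pi / (3 * \<delta>\<^sup>2))"
      by (intro mult_left_mono nn_integral_norm_power4_le \<delta>) auto
    also have "\<dots> = ennreal (48 * pi)"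
      using \<delta> by (simp add: ennreal_mult[symmetric])
    finally show ?thesis .
  qed
qed

subsection \<open>The Dirichlet space\<close>

lemma
  assumes "f \<in> dirichlet_space"
  shows dirichlet_space_holomorphic: "f holomorphic_on unit_disc"
    and dirichlet_space_deriv_holomorphic: "deriv f holomorphic_on unit_disc"
    and continuous_on_dirichlet_density: "continuous_on unit_disc (\<lambda>w. (cmod (deriv f w))\<^sup>2)"
    and dirichlet_space_integrable:
      "integrable lborel (\<lambda>w. indicator unit_disc w * (cmod (deriv f w))\<^sup>2)"
proof -
  show 1: "f holomorphic_on unit_disc"
    using assms by (simp add: dirichlet_space_def)
  then show 2: "deriv f holomorphic_on unit_disc"
    by (intro holomorphic_deriv) auto
  then show 3: "continuous_on unit_disc (\<lambda>w. (cmod (deriv f w))\<^sup>2)"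
    by (intro continuous_intros holomorphic_on_imp_continuous_on)
  show "integrable lborel (\<lambda>w. indicator unit_disc w * (cmod (deriv f w))\<^sup>2)"
    using assms integrable_disc_area_iff[OF 3] by (simp add: dirichlet_space_def)
qed

text \<open>The ball has half the distance from \<open>z\<close> to the circle as radius
  \<open>r\<close>, and \<open>1 - (cmod z)\<^sup>2 \<le> 2 * (1 - cmod z) = 4 * r\<close> produces
  the 16. Keeping the integral local serves two purposes: enlarging the ball to the disc gives a
  norm bound, and letting it approach the circle gives a little-o estimate.\<close>

lemma deriv_submean_value:
  assumes f: "f \<in> dirichlet_space" and z: "cmod z < 1"
  shows "pi * ((1 - (cmod z)\<^sup>2) * cmod (deriv f z))\<^sup>2
    \<le> 16 * (LINT w|lborel. indicator (ball z ((1 - cmod z) / 2)) w * (cmod (deriv f w))\<^sup>2)"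
proof -
  let ?r = "(1 - cmod z) / 2"
  have "ball z (1 - cmod z) \<subseteq> unit_disc"
    by (simp add: ball_subset_ball_iff)
  then have "deriv f holomorphic_on ball z (1 - cmod z)"
    using dirichlet_space_deriv_holomorphic[OF f] holomorphic_on_subset by blast
  then have mean: "pi * ?r\<^sup>2 * (cmod (deriv f z))\<^sup>2
      \<le> (LINT w|lborel. indicator (ball z ?r) w * (cmod (deriv f w))\<^sup>2)"
    using z by (intro area_submean_value) auto
  have "((1 - (cmod z)\<^sup>2) * cmod (deriv f z))\<^sup>2 \<le> 16 * (?r\<^sup>2 * (cmod (deriv f z))\<^sup>2)"
  proof -
    have "1 - (cmod z)\<^sup>2 = (1 + cmod z) * (1 - cmod z)"
      by (simp add: power2_eq_square algebra_simps)
    also have "\<dots> \<le> 2 * (1 - cmod z)"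
      using z by (intro mult_right_mono) auto
    finally have "1 - (cmod z)\<^sup>2 \<le> 4 * ?r"
      by simp
    moreover have "0 \<le> 1 - (cmod z)\<^sup>2"
      using z by (simp add: power_le_one)
    ultimately have "(1 - (cmod z)\<^sup>2)\<^sup>2 \<le> (4 * ?r)\<^sup>2"
      by (intro power_mono)
    then have "(1 - (cmod z)\<^sup>2)\<^sup>2 * (cmod (deriv f z))\<^sup>2 \<le> (4 * ?r)\<^sup>2 * (cmod (deriv f z))\<^sup>2"
      by (intro mult_right_mono) auto
    then show ?thesis
      by (simp only: power_mult_distrib) simp
  qed
  then have "pi * ((1 - (cmod z)\<^sup>2) * cmod (deriv f z))\<^sup>2 \<le> pi * (16 * (?r\<^sup>2 * (cmod (deriv f z))\<^sup>2))"
    by (intro mult_left_mono) auto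
  also have "\<dots> = 16 * (pi * ?r\<^sup>2 * (cmod (deriv f z))\<^sup>2)"
    by simp
  finally show ?thesis
    using mean by linarith
qed

lemma deriv_le_dirichlet_norm:
  assumes f: "f \<in> dirichlet_space" and z: "cmod z < 1"
  shows "(1 - (cmod z)\<^sup>2) * cmod (deriv f z) \<le> 4 * dirichlet_norm f"
proof -
  let ?f = "\<lambda>w. (cmod (deriv f w))\<^sup>2" and ?B = "ball z ((1 - cmod z) / 2)"
  have B: "?B \<subseteq> unit_disc"
    using z by (simp add: ball_subset_ball_iff field_simps)
  then have ind: "indicator ?B w \<le> (indicator unit_disc w :: real)" for w
    by (meson indicator_leI subsetD)
  have "integrable lborel (\<lambda>w. indicator ?B w * ?f w)"
  proof (rule Bochner_Integration.integrable_bound[OF dirichlet_space_integrable[OF f]])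
    show "(\<lambda>w. indicator ?B w * ?f w) \<in> borel_measurable lborel"
      using borel_measurable_continuous_on_indicator[of ?B ?f]
        continuous_on_subset[OF continuous_on_dirichlet_density[OF f] B] by simp
  qed (simp add: abs_mult mult_right_mono ind)
  then have "(LINT w|lborel. indicator ?B w * ?f w) \<le> (LINT w|lborel. indicator unit_disc w * ?f w)"
    by (intro integral_mono dirichlet_space_integrable[OF f] mult_right_mono ind) auto
  also have "\<dots> = pi * (LINT w|disc_area. ?f w)"
    using integral_disc_area_eq[OF continuous_on_dirichlet_density[OF f]] by simp
  also have "\<dots> \<le> pi * (dirichlet_norm f)\<^sup>2"
  proof -
    have "0 \<le> (LINT w|disc_area. ?f w)"
      by (intro integral_nonneg_AE) auto
    then show ?thesis
      by (simp add: dirichlet_norm_def)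
  qed
  finally have "pi * ((1 - (cmod z)\<^sup>2) * cmod (deriv f z))\<^sup>2 \<le> 16 * (pi * (dirichlet_norm f)\<^sup>2)"
    using deriv_submean_value[OF f z] by linarith
  also have "\<dots> = pi * (4 * dirichlet_norm f)\<^sup>2"
    by (simp add: power_mult_distrib)
  finally have "pi * ((1 - (cmod z)\<^sup>2) * cmod (deriv f z))\<^sup>2 \<le> pi * (4 * dirichlet_norm f)\<^sup>2" .
  then have "((1 - (cmod z)\<^sup>2) * cmod (deriv f z))\<^sup>2 \<le> (4 * dirichlet_norm f)\<^sup>2"
    by simp
  moreover have "0 \<le> 4 * dirichlet_norm f"
    by (simp add: dirichlet_norm_def)
  ultimately show ?thesis
    by (rule power2_le_imp_le)
qed

text \<open>The balls in the local estimate move out to the circle and eventually miss every fixed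
  point, so dominated convergence sends their Dirichlet integrals to 0.\<close>

lemma deriv_dirichlet_tendsto_0:
  assumes f: "f \<in> dirichlet_space" and z: "\<And>n. cmod (z n) < 1"
    and lim: "(\<lambda>n. cmod (z n)) \<longlonglongrightarrow> 1"
  shows "(\<lambda>n. (1 - (cmod (z n))\<^sup>2) * cmod (deriv f (z n))) \<longlonglongrightarrow> 0"
proof -
  let ?f = "\<lambda>w. (cmod (deriv f w))\<^sup>2" and ?B = "\<lambda>n. ball (z n) ((1 - cmod (z n)) / 2)"
  have B: "?B n \<subseteq> unit_disc" for n
    using z[of n] by (simp add: ball_subset_ball_iff field_simps)
  then have ind: "indicator (?B n) w \<le> (indicator unit_disc w :: real)" for n w
    by (meson indicator_leI subsetD)
  have "(\<lambda>n. LINT w|lborel. indicator (?B n) w * ?f w) \<longlonglongrightarrow> (LINT w|(lborel :: complex measure). 0)"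
  proof (rule integral_dominated_convergence)
    show "integrable lborel (\<lambda>w. indicator unit_disc w * ?f w)"
      by (rule dirichlet_space_integrable[OF f])
    show "(\<lambda>w. indicator (?B n) w * ?f w) \<in> borel_measurable lborel" for n
      using borel_measurable_continuous_on_indicator[of "?B n" ?f]
        continuous_on_subset[OF continuous_on_dirichlet_density[OF f] B] by simp
    show "AE w in lborel. norm (indicator (?B n) w * ?f w) \<le> indicator unit_disc w * ?f w" for n
      by (simp add: abs_mult mult_right_mono ind)
    have "(\<lambda>n. indicator (?B n) w * ?f w) \<longlonglongrightarrow> 0" for w
    proof (rule tendsto_eventually)
      show "\<forall>\<^sub>F n in sequentially. indicator (?B n) w * ?f w = 0"
      proof (cases "cmod w < 1")
        case True
        \<comment> \<open>This threshold solves \<open>cmod z - cmod w = (1 - cmod z) / 2\<close>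
          for \<open>cmod z\<close>; beyond it the ball around \<open>z n\<close> no longer contains
          \<open>w\<close>.\<close>
        then have "(1 + 2 * cmod w) / 3 < 1"
          by simp
        then have "\<forall>\<^sub>F n in sequentially. (1 + 2 * cmod w) / 3 < cmod (z n)"
          using lim by (rule order_tendstoD(1)[rotated])
        then show ?thesis
        proof eventually_elim
          case (elim n)
          then have "w \<notin> ?B n"
            using norm_triangle_ineq2[of "z n" w] by (auto simp: dist_norm)
          then show ?case
            by simp
        qed
      next
        case False
        then have "w \<notin> ?B n" for n
          using B[of n] by (auto simp del: mem_ball simp: subset_iff)
        then show ?thesis
          by simp
      qed
    qed
    then show "AE w in lborel. (\<lambda>n. indicator (?B n) w * ?f w) \<longlonglongrightarrow> 0"
      by simp
  qed simp
  then have "(\<lambda>n. sqrt (16 / pi * (LINT w|lborel. indicator (?B n) w * ?f w))) \<longlonglongrightarrow> sqrt (16 / pi * 0)"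
    by (intro tendsto_intros) simp
  then have lim0: "(\<lambda>n. sqrt (16 / pi * (LINT w|lborel. indicator (?B n) w * ?f w))) \<longlonglongrightarrow> 0"
    by simp
  show ?thesis
  proof (rule tendsto_sandwich[OF _ _ tendsto_const lim0]; intro always_eventually allI)
    fix n
    show "0 \<le> (1 - (cmod (z n))\<^sup>2) * cmod (deriv f (z n))"
      using z[of n] by (simp add: power_le_one)
    show "(1 - (cmod (z n))\<^sup>2) * cmod (deriv f (z n)) \<le>
        sqrt (16 / pi * (LINT w|lborel. indicator (?B n) w * ?f w))"
      using deriv_submean_value[OF f z[of n]] by (intro real_le_rsqrt) (simp add: field_simps)
  qed
qed

section \<open>Differences in the Dirichlet space and compact operators\<close>

lemma dirichlet_space_diff:
  assumes f: "f \<in> dirichlet_space" and g: "g \<in> dirichlet_space"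
  shows "f - g \<in> dirichlet_space"
    and "\<And>w. w \<in> unit_disc \<Longrightarrow> deriv (f - g) w = deriv f w - deriv g w"
proof -
  note hf = dirichlet_space_holomorphic[OF f] and hg = dirichlet_space_holomorphic[OF g]
  have h: "(f - g) holomorphic_on unit_disc"
    using holomorphic_on_diff[OF hf hg] by (simp add: fun_diff_def)
  show d: "deriv (f - g) w = deriv f w - deriv g w" if "w \<in> unit_disc" for w
    using that hf hg by (simp add: fun_diff_def holomorphic_on_imp_differentiable_at[OF _ open_ball])
  have cont: "continuous_on unit_disc (\<lambda>w. (cmod (deriv (f - g) w))\<^sup>2)"
    using holomorphic_deriv[OF h] by (intro continuous_intros holomorphic_on_imp_continuous_on) auto
  have "integrable lborel (\<lambda>w. indicator unit_disc w * (cmod (deriv (f - g) w))\<^sup>2)"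
  proof (rule Bochner_Integration.integrable_bound)
    show "integrable lborel (\<lambda>w. 2 * (indicator unit_disc w * (cmod (deriv f w))\<^sup>2) +
        2 * (indicator unit_disc w * (cmod (deriv g w))\<^sup>2))"
      using dirichlet_space_integrable[OF f] dirichlet_space_integrable[OF g] by simp
    show "(\<lambda>w. indicator unit_disc w * (cmod (deriv (f - g) w))\<^sup>2) \<in> borel_measurable lborel"
      using borel_measurable_continuous_on_indicator[OF _ cont] by simp
    have "(cmod (x - y))\<^sup>2 \<le> 2 * (cmod x)\<^sup>2 + 2 * (cmod y)\<^sup>2" for x y
    proof -
      have "(cmod (x - y))\<^sup>2 \<le> (cmod x + cmod y)\<^sup>2"
        by (intro power_mono norm_triangle_ineq4) auto
      also have "\<dots> \<le> 2 * (cmod x)\<^sup>2 + 2 * (cmod y)\<^sup>2"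
        using sum_squares_bound[of "cmod x" "cmod y"] by (simp add: power2_sum)
      finally show ?thesis .
    qed
    then show "AE w in lborel. norm (indicator unit_disc w * (cmod (deriv (f - g) w))\<^sup>2) \<le>
        norm (2 * (indicator unit_disc w * (cmod (deriv f w))\<^sup>2) +
          2 * (indicator unit_disc w * (cmod (deriv g w))\<^sup>2))"
      by (auto simp: indicator_def d)
  qed
  then show "f - g \<in> dirichlet_space"
    using h integrable_disc_area_iff[OF cont] by (simp add: dirichlet_space_def)
qed

text \<open>No weak convergence of the test functions is needed: along a subsequence the images are close
  in norm to one fixed function of the space, whose derivative satisfies the little-o estimate.\<close>

lemma compact_deriv_tendsto_0:
  assumes T: "compact_on_dirichlet T"
    and F: "\<And>z. cmod z < 1 \<Longrightarrow> F z \<in> dirichlet_space"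
    and B: "\<And>z. cmod z < 1 \<Longrightarrow> dirichlet_norm (F z) \<le> B"
  shows "((\<lambda>z. (1 - (cmod z)\<^sup>2) * cmod (deriv (T (F z)) z)) \<longlongrightarrow> 0) to_unit_circle"
proof (rule ccontr)
  let ?Q = "\<lambda>z. (1 - (cmod z)\<^sup>2) * cmod (deriv (T (F z)) z)"
  assume "\<not> (?Q \<longlongrightarrow> 0) to_unit_circle"
  then obtain e where e: "e > 0" and ev: "\<not> (\<forall>\<^sub>F z in to_unit_circle. \<bar>?Q z\<bar> < e)"
    by (auto simp: tendsto_iff)
  have "\<exists>z. cmod z < 1 \<and> 1 - 1 / real (Suc n) < cmod z \<and> e \<le> \<bar>?Q z\<bar>" for n
  proof (rule ccontr)
    assume *: "\<not> ?thesis"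
    have "\<forall>\<^sub>F x in at_left 1. 1 - 1 / real (Suc n) < x \<and> x < (1::real)"
      using eventually_at_left_real[of "1 - 1 / real (Suc n)" 1] by (simp add: greaterThanLessThan_iff)
    then have "\<forall>\<^sub>F z in to_unit_circle. 1 - 1 / real (Suc n) < cmod z \<and> cmod z < 1"
      by (auto simp: eventually_filtercomap)
    then have "\<forall>\<^sub>F z in to_unit_circle. \<bar>?Q z\<bar> < e"
      by eventually_elim (use * in \<open>auto simp: not_le\<close>)
    with ev show False ..
  qed
  then obtain z where z: "\<And>n. cmod (z n) < 1" "\<And>n. 1 - 1 / real (Suc n) < cmod (z n)"
      "\<And>n. e \<le> \<bar>?Q (z n)\<bar>"
    by metis
  have "(\<lambda>n. 1 - 1 / real (Suc n)) \<longlonglongrightarrow> 1 - 0"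
    by (intro tendsto_diff tendsto_const LIMSEQ_Suc lim_1_over_n)
  then have "(\<lambda>n. 1 - 1 / real (Suc n)) \<longlonglongrightarrow> 1"
    by simp
  then have lim: "(\<lambda>n. cmod (z n)) \<longlonglongrightarrow> 1"
    by (rule tendsto_sandwich[OF _ _ _ tendsto_const, rotated 2])
      (intro always_eventually allI less_imp_le z(1,2))+
  obtain r g where r: "strict_mono (r :: nat \<Rightarrow> nat)" and g: "g \<in> dirichlet_space"
    and conv: "(\<lambda>n. dirichlet_norm (T (F (z (r n))) - g)) \<longlonglongrightarrow> 0"
  proof -
    have "\<forall>n. F (z n) \<in> dirichlet_space" "\<exists>B. \<forall>n. dirichlet_norm (F (z n)) \<le> B"
      using F B z(1) by auto
    from T[unfolded compact_on_dirichlet_def, THEN conjunct2, THEN spec, THEN mp, OF conjI[OF this]]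
    show thesis
      using that by auto
  qed
  have TF: "T (F (z n)) \<in> dirichlet_space" for n
    using T F z(1) by (auto simp: compact_on_dirichlet_def)
  have g0: "(\<lambda>n. (1 - (cmod (z (r n)))\<^sup>2) * cmod (deriv g (z (r n)))) \<longlonglongrightarrow> 0"
    using LIMSEQ_subseq_LIMSEQ[OF lim r] by (intro deriv_dirichlet_tendsto_0 g z) (simp add: o_def)
  \<comment> \<open>The derivative of the image is split at the limit \<open>g\<close>: the
    pointwise norm bound controls the difference, and the little-o estimate controls
    \<open>g\<close>. Both terms tend to 0, which contradicts \<open>e > 0\<close>.\<close>
  have "e \<le> 4 * dirichlet_norm (T (F (z (r n))) - g) +
      (1 - (cmod (z (r n)))\<^sup>2) * cmod (deriv g (z (r n)))" for n
  proof -
    let ?z = "z (r n)" and ?h = "T (F (z (r n)))"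
    have nonneg: "0 \<le> 1 - (cmod ?z)\<^sup>2"
      using z(1)[of "r n"] by (simp add: power_le_one)
    have "deriv ?h ?z = deriv (?h - g) ?z + deriv g ?z"
      using dirichlet_space_diff(2)[OF TF g, of ?z] z(1) by simp
    then have "cmod (deriv ?h ?z) \<le> cmod (deriv (?h - g) ?z) + cmod (deriv g ?z)"
      by (metis norm_triangle_ineq)
    then have "?Q ?z \<le> (1 - (cmod ?z)\<^sup>2) * (cmod (deriv (?h - g) ?z) + cmod (deriv g ?z))"
      using nonneg by (intro mult_left_mono)
    also have "\<dots> \<le> 4 * dirichlet_norm (?h - g) + (1 - (cmod ?z)\<^sup>2) * cmod (deriv g ?z)"
      using deriv_le_dirichlet_norm[OF dirichlet_space_diff(1)[OF TF g] z(1)]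
      by (simp add: distrib_left)
    finally show ?thesis
      using z(3)[of "r n"] nonneg by simp
  qed
  moreover have "(\<lambda>n. 4 * dirichlet_norm (T (F (z (r n))) - g) +
      (1 - (cmod (z (r n)))\<^sup>2) * cmod (deriv g (z (r n)))) \<longlonglongrightarrow> 4 * 0 + 0"
    by (intro tendsto_add tendsto_mult tendsto_const conv g0)
  ultimately have "e \<le> 4 * 0 + 0"
    by (intro LIMSEQ_le_const) auto
  with e show False
    by simp
qed

subsection \<open>Test functions and the theorem\<close>

lemma deriv_Moebius_function:
  assumes "cmod a < 1" "cmod w < 1"
  shows "deriv (Moebius_function 0 a) w = (1 - (cmod a)\<^sup>2) / (1 - cnj a * w)\<^sup>2"
  using has_field_derivative_Moebius_function[OF assms] by (rule DERIV_imp_deriv)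

lemma one_minus_norm_Moebius_sq:
  assumes "cmod a < 1" "cmod w < 1"
  shows "1 - (cmod (Moebius_function 0 a w))\<^sup>2 =
    (1 - (cmod a)\<^sup>2) * (1 - (cmod w)\<^sup>2) / (cmod (1 - cnj a * w))\<^sup>2"
proof -
  have "(cmod (1 - cnj a * w))\<^sup>2 - (cmod (w - a))\<^sup>2 = (1 - (cmod a)\<^sup>2) * (1 - (cmod w)\<^sup>2)"
    unfolding cmod_power2 by (simp add: algebra_simps power2_eq_square)
  then show ?thesis
    using one_minus_cnj_mult_nonzero[OF assms]
    by (simp add: Moebius_function_simple norm_divide field_simps)
qed

text \<open>This is the equality case of the Schwarz-Pick lemma: automorphisms are isometries of the
  hyperbolic metric.\<close>

lemma norm_deriv_Moebius_function:
  assumes "cmod a < 1" "cmod w < 1"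
  shows "cmod (deriv (Moebius_function 0 a) w) * (1 - (cmod w)\<^sup>2) =
    1 - (cmod (Moebius_function 0 a w))\<^sup>2"
proof -
  have "0 \<le> 1 - (cmod a)\<^sup>2"
    using assms by (simp add: power_le_one)
  then have "cmod (1 - complex_of_real ((cmod a)\<^sup>2)) = 1 - (cmod a)\<^sup>2"
    by (metis abs_of_nonneg norm_of_real of_real_1 of_real_diff)
  then show ?thesis
    by (simp add: deriv_Moebius_function one_minus_norm_Moebius_sq assms norm_divide norm_power)
qed

text \<open>The factor 2 lets one bound serve both the automorphism \<open>m\<close> and its square,
  whose derivative is \<open>2 * m * m'\<close> with \<open>cmod m < 1\<close>. The Dirichlet
  integral is at most \<open>4 * 48 = 192\<close>, and
  \<open>192 + 1 \<le> 14\<^sup>2\<close>.\<close>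

lemma dirichlet_norm_le_Moebius:
  assumes a: "cmod a < 1" and h: "h holomorphic_on unit_disc" and h0: "cmod (h 0) \<le> 1"
    and le: "\<And>w. cmod w < 1 \<Longrightarrow> cmod (deriv h w) \<le> 2 * cmod (deriv (Moebius_function 0 a) w)"
  shows "h \<in> dirichlet_space" "dirichlet_norm h \<le> 14"
proof -
  have cont: "continuous_on unit_disc (\<lambda>w. (cmod (deriv h w))\<^sup>2)"
    using holomorphic_deriv[OF h] by (intro continuous_intros holomorphic_on_imp_continuous_on) auto
  have "indicator unit_disc w * ennreal ((cmod (deriv h w))\<^sup>2) \<le> ennreal 4 *
      (indicator unit_disc w * ennreal ((cmod ((1 - (cmod a)\<^sup>2) / (1 - cnj a * w)\<^sup>2))\<^sup>2))" for w
  proof (cases "cmod w < 1")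
    case True
    have "(cmod (deriv h w))\<^sup>2 \<le> (2 * cmod ((1 - (cmod a)\<^sup>2) / (1 - cnj a * w)\<^sup>2))\<^sup>2"
      using le[OF True] by (intro power_mono) (simp_all only: deriv_Moebius_function[OF a True] norm_ge_zero)
    then have "(cmod (deriv h w))\<^sup>2 \<le> 4 * (cmod ((1 - (cmod a)\<^sup>2) / (1 - cnj a * w)\<^sup>2))\<^sup>2"
      by (simp only: power_mult_distrib) simp
    then show ?thesis
      using True ennreal_leI[of _ "4 * _"] by (simp add: ennreal_mult' del: of_real_diff)
  qed auto
  then have "(\<integral>\<^sup>+w. indicator unit_disc w * ennreal ((cmod (deriv h w))\<^sup>2) \<partial>lborel) \<le> (\<integral>\<^sup>+w. ennreal 4 *
      (indicator unit_disc w * ennreal ((cmod ((1 - (cmod a)\<^sup>2) / (1 - cnj a * w)\<^sup>2))\<^sup>2)) \<partial>lborel)"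
    by (rule nn_integral_mono)
  also have "\<dots> = ennreal 4 * (\<integral>\<^sup>+w. indicator unit_disc w *
      ennreal ((cmod ((1 - (cmod a)\<^sup>2) / (1 - cnj a * w)\<^sup>2))\<^sup>2) \<partial>lborel)"
    by (rule nn_integral_cmult) (auto intro!: borel_measurable_times_ennreal borel_measurable_indicator)
  also have "\<dots> \<le> ennreal 4 * ennreal (48 * pi)"
    by (intro mult_left_mono nn_integral_deriv_Moebius_le[OF a]) auto
  also have "\<dots> = ennreal (192 * pi)"
    using ennreal_mult'[of 4 "48 * pi"] by simp
  also have "(\<integral>\<^sup>+w. indicator unit_disc w * ennreal ((cmod (deriv h w))\<^sup>2) \<partial>lborel) =
      (\<integral>\<^sup>+w. ennreal (indicator unit_disc w * (cmod (deriv h w))\<^sup>2) \<partial>lborel)"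
    by (intro nn_integral_cong) (auto simp: indicator_def)
  finally have nn: "(\<integral>\<^sup>+w. ennreal (indicator unit_disc w * (cmod (deriv h w))\<^sup>2) \<partial>lborel)
      \<le> ennreal (192 * pi)" .
  have meas: "(\<lambda>w. indicator unit_disc w * (cmod (deriv h w))\<^sup>2) \<in> borel_measurable lborel"
    using borel_measurable_continuous_on_indicator[OF _ cont] by simp
  then have int: "integrable lborel (\<lambda>w. indicator unit_disc w * (cmod (deriv h w))\<^sup>2)"
    by (rule integrableI_nonneg) (use nn in \<open>auto intro: le_less_trans\<close>)
  then show "h \<in> dirichlet_space"
    using h integrable_disc_area_iff[OF cont] by (simp add: dirichlet_space_def)
  have "ennreal (LINT w|lborel. indicator unit_disc w * (cmod (deriv h w))\<^sup>2) \<le> ennreal (192 * pi)"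
    using nn_integral_eq_integral[OF int] nn by simp
  then have "(LINT w|disc_area. (cmod (deriv h w))\<^sup>2) \<le> 192"
    by (simp add: integral_disc_area_eq[OF cont] field_simps)
  moreover have "(cmod (h 0))\<^sup>2 \<le> 1"
    using h0 by (simp add: power_le_one)
  ultimately show "dirichlet_norm h \<le> 14"
    unfolding dirichlet_norm_def by (intro real_le_lsqrt) (auto intro!: add_nonneg_nonneg integral_nonneg_AE)
qed

lemma Moebius_function_dirichlet:
  assumes a: "cmod a < 1"
  shows "Moebius_function 0 a \<in> dirichlet_space" "dirichlet_norm (Moebius_function 0 a) \<le> 14"
  by (rule dirichlet_norm_le_Moebius[OF a Moebius_function_holomorphic[OF a]];
      use a in \<open>simp add: Moebius_function_of_zero\<close>)+

lemma deriv_Moebius_function_sq: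
  assumes "cmod a < 1" "cmod w < 1"
  shows "deriv (\<lambda>w. (Moebius_function 0 a w)\<^sup>2) w =
    2 * Moebius_function 0 a w * deriv (Moebius_function 0 a) w"
proof -
  note d = has_field_derivative_Moebius_function[OF assms]
  show ?thesis
    unfolding DERIV_imp_deriv[OF d]
    by (rule DERIV_imp_deriv) (auto intro!: derivative_eq_intros d)
qed

lemma Moebius_function_sq_dirichlet:
  assumes a: "cmod a < 1"
  shows "(\<lambda>w. (Moebius_function 0 a w)\<^sup>2) \<in> dirichlet_space"
    and "dirichlet_norm (\<lambda>w. (Moebius_function 0 a w)\<^sup>2) \<le> 14"
proof -
  have h: "(\<lambda>w. (Moebius_function 0 a w)\<^sup>2) holomorphic_on unit_disc"
    using Moebius_function_holomorphic[OF a] by (intro holomorphic_intros)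
  have 0: "cmod ((Moebius_function 0 a 0)\<^sup>2) \<le> 1"
    using a by (simp add: Moebius_function_of_zero norm_power power_le_one)
  have le: "cmod (deriv (\<lambda>w. (Moebius_function 0 a w)\<^sup>2) w) \<le> 2 * cmod (deriv (Moebius_function 0 a) w)"
    if "cmod w < 1" for w
    using Moebius_function_norm_lt_1[OF a that, of 0]
    by (simp add: deriv_Moebius_function_sq[OF a that] norm_mult mult_left_le_one_le)
  show "(\<lambda>w. (Moebius_function 0 a w)\<^sup>2) \<in> dirichlet_space"
    "dirichlet_norm (\<lambda>w. (Moebius_function 0 a w)\<^sup>2) \<le> 14"
    using dirichlet_norm_le_Moebius[OF a h 0 le] by auto
qed

section \<open>Hyperbolic derivatives near the circle\<close>

lemma eventually_to_unit_circle: "\<forall>\<^sub>F z in to_unit_circle. cmod z < 1"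
  by (auto simp: eventually_filtercomap eventually_at_filter intro!: exI[of _ "\<lambda>x. x < 1"])

lemma pseudohyp_dist_commute: "pseudohyp_dist \<phi> \<psi> z = pseudohyp_dist \<psi> \<phi> z"
proof -
  have "cmod (1 - cnj (\<phi> z) * \<psi> z) = cmod (cnj (1 - cnj (\<phi> z) * \<psi> z))"
    by (simp only: complex_mod_cnj)
  then show ?thesis
    by (simp add: pseudohyp_dist_def norm_divide norm_minus_commute mult.commute)
qed

text \<open>Compactness enters only through its effect on test families, a condition symmetric in
  \<phi> and \<psi> up to a sign inside \<open>cmod\<close>. The lemma can therefore be used again
  with the two maps exchanged.\<close>

lemma pseudohyp_deriv_tendsto_0:
  assumes \<phi>: "analytic_self_map \<phi>" and \<psi>: "analytic_self_map \<psi>"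
    and test: "\<And>F. (\<And>z. cmod z < 1 \<Longrightarrow> F z \<in> dirichlet_space \<and> dirichlet_norm (F z) \<le> 14) \<Longrightarrow>
      ((\<lambda>z. (1 - (cmod z)\<^sup>2) * cmod (deriv (F z) (\<phi> z) * deriv \<phi> z - deriv (F z) (\<psi> z) * deriv \<psi> z))
        \<longlongrightarrow> 0) to_unit_circle"
  shows "((\<lambda>z. pseudohyp_dist \<phi> \<psi> z * (cmod (deriv \<phi> z) * (1 - (cmod z)\<^sup>2) / (1 - (cmod (\<phi> z))\<^sup>2)))
    \<longlongrightarrow> 0) to_unit_circle"
proof -
  have maps: "cmod (\<phi> z) < 1" "cmod (\<psi> z) < 1" if "cmod z < 1" for z
    using \<phi> \<psi> that by (force simp: analytic_self_map_def)+
  define m where "m z = Moebius_function 0 (\<phi> z)" for z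
  define E1 where "E1 z = (1 - (cmod z)\<^sup>2) *
    cmod (deriv (m z) (\<phi> z) * deriv \<phi> z - deriv (m z) (\<psi> z) * deriv \<psi> z)" for z
  define E2 where "E2 z = (1 - (cmod z)\<^sup>2) * cmod (deriv (\<lambda>w. (m z w)\<^sup>2) (\<phi> z) * deriv \<phi> z -
    deriv (\<lambda>w. (m z w)\<^sup>2) (\<psi> z) * deriv \<psi> z)" for z
  have lim: "((\<lambda>z. E1 z + E2 z) \<longlongrightarrow> 0 + 0) to_unit_circle"
    unfolding E1_def E2_def m_def
    by (intro tendsto_add test conjI Moebius_function_dirichlet Moebius_function_sq_dirichlet maps)
  have bound: "pseudohyp_dist \<phi> \<psi> z * (cmod (deriv \<phi> z) * (1 - (cmod z)\<^sup>2) / (1 - (cmod (\<phi> z))\<^sup>2))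
      \<le> E1 z + E2 z" if z: "cmod z < 1" for z
  proof -
    let ?a = "\<phi> z" and ?b = "\<psi> z"
    define s where "s = 1 - (cmod z)\<^sup>2"
    define \<rho> where "\<rho> = cmod (m z ?b)"
    define A where "A = cmod (deriv \<phi> z) * s / (1 - (cmod ?a)\<^sup>2)"
    define B where "B = cmod (deriv \<psi> z) * s / (1 - (cmod ?b)\<^sup>2)"
    note a = maps(1)[OF z] and b = maps(2)[OF z]
    have pos: "0 < 1 - (cmod ?a)\<^sup>2" "0 < 1 - (cmod ?b)\<^sup>2" "0 \<le> s"
      using a b z by (simp_all add: s_def power_less_one_iff power_le_one)
    have \<rho>: "0 \<le> \<rho>" "\<rho> < 1"
      using Moebius_function_norm_lt_1[OF a b] by (simp_all add: \<rho>_def m_def)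
    have \<rho>_eq: "pseudohyp_dist \<phi> \<psi> z = \<rho>"
      by (simp add: \<rho>_def m_def Moebius_function_simple pseudohyp_dist_def norm_divide norm_minus_commute)
    have m0: "m z ?a = 0"
      by (simp add: m_def Moebius_function_eq_zero)
    \<comment> \<open>By the Schwarz-Pick equality, \<open>m z\<close> has hyperbolic derivative 1
      at its zero \<open>\<phi> z\<close> and \<open>1 - \<rho>\<^sup>2\<close> at
      \<open>\<psi> z\<close>. Hence the two terms in \<open>E1 z\<close> have sizes
      \<open>A\<close> and \<open>(1 - \<rho>\<^sup>2) * B\<close>.\<close>
    have "cmod (deriv (m z) ?a) * (1 - (cmod ?a)\<^sup>2) = 1"
      using norm_deriv_Moebius_function[OF a a] m0 by (simp add: m_def)
    then have "cmod (deriv (m z) ?a) = 1 / (1 - (cmod ?a)\<^sup>2)"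
      using pos by (simp add: field_simps)
    then have da: "s * cmod (deriv (m z) ?a * deriv \<phi> z) = A"
      by (simp add: A_def norm_mult)
    have "cmod (deriv (m z) ?b) * (1 - (cmod ?b)\<^sup>2) = 1 - \<rho>\<^sup>2"
      using norm_deriv_Moebius_function[OF a b] by (simp add: m_def \<rho>_def)
    then have "cmod (deriv (m z) ?b) = (1 - \<rho>\<^sup>2) / (1 - (cmod ?b)\<^sup>2)"
      using pos by (simp add: field_simps)
    then have db: "s * cmod (deriv (m z) ?b * deriv \<psi> z) = (1 - \<rho>\<^sup>2) * B"
      by (simp add: B_def norm_mult)
    have "A - (1 - \<rho>\<^sup>2) * B \<le> E1 z"
      unfolding da[symmetric] db[symmetric] E1_def s_def[symmetric] right_diff_distrib[symmetric]
      using pos by (intro mult_left_mono norm_triangle_ineq2)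
    then have "\<rho> * (A - (1 - \<rho>\<^sup>2) * B) \<le> \<rho> * E1 z"
      using \<rho> by (intro mult_left_mono)
    moreover have "\<rho> * E1 z \<le> E1 z"
      using \<rho> pos by (intro mult_left_le_one_le) (auto simp: E1_def s_def)
    \<comment> \<open>The square of \<open>m z\<close> has a double zero at \<open>\<phi> z\<close>,
      so only the \<psi> term survives and \<open>B\<close> is isolated.\<close>
    moreover have "E2 z = 2 * \<rho> * ((1 - \<rho>\<^sup>2) * B)"
    proof -
      have "deriv (\<lambda>w. (m z w)\<^sup>2) ?a = 0"
        using deriv_Moebius_function_sq[OF a a] m0 by (simp add: m_def)
      moreover have "deriv (\<lambda>w. (m z w)\<^sup>2) ?b = 2 * m z ?b * deriv (m z) ?b"
        using deriv_Moebius_function_sq[OF a b] by (simp add: m_def)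
      ultimately show ?thesis
        unfolding db[symmetric] by (simp add: E2_def s_def \<rho>_def norm_mult)
    qed
    moreover have "0 \<le> \<rho> * ((1 - \<rho>\<^sup>2) * B)"
      using \<rho> pos by (auto simp: B_def power_le_one intro!: mult_nonneg_nonneg divide_nonneg_nonneg)
    \<comment> \<open>The chain is \<open>\<rho> * A \<le> \<rho> * E1 z + \<rho> * (1 -
      \<rho>\<^sup>2) * B \<le> E1 z + E2 z / 2\<close>; nonnegativity of \<open>E2 z\<close> allows
      dropping the half.\<close>
    ultimately have "\<rho> * A \<le> E1 z + E2 z"
      unfolding right_diff_distrib by linarith
    then show ?thesis
      by (simp add: \<rho>_eq A_def s_def)
  qed
  show ?thesis
  proof (rule tendsto_sandwich[OF _ _ tendsto_const])
    show "((\<lambda>z. E1 z + E2 z) \<longlongrightarrow> 0) to_unit_circle"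
      using lim by simp
    show "\<forall>\<^sub>F z in to_unit_circle. pseudohyp_dist \<phi> \<psi> z *
        (cmod (deriv \<phi> z) * (1 - (cmod z)\<^sup>2) / (1 - (cmod (\<phi> z))\<^sup>2)) \<le> E1 z + E2 z"
      using eventually_to_unit_circle by eventually_elim (rule bound)
    show "\<forall>\<^sub>F z in to_unit_circle. 0 \<le> pseudohyp_dist \<phi> \<psi> z *
        (cmod (deriv \<phi> z) * (1 - (cmod z)\<^sup>2) / (1 - (cmod (\<phi> z))\<^sup>2))"
      using eventually_to_unit_circle
    proof eventually_elim
      case (elim z)
      with maps(1)[OF elim] show ?case
        by (auto simp: pseudohyp_dist_def power_le_one intro!: mult_nonneg_nonneg divide_nonneg_nonneg)
    qed
  qed
qed

theorem theorem3p2: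
  fixes \<phi> \<psi> :: "complex \<Rightarrow> complex"
  assumes "analytic_self_map \<phi>" and "analytic_self_map \<psi>"
    and "bounded_on_dirichlet (composition_operator \<phi>)"
    and "bounded_on_dirichlet (composition_operator \<psi>)"
    and "compact_on_dirichlet (composition_operator \<phi> - composition_operator \<psi>)"
  shows "((\<lambda>z. pseudohyp_dist \<phi> \<psi> z *
             (cmod (deriv \<phi> z) * (1 - (cmod z)\<^sup>2) / (1 - (cmod (\<phi> z))\<^sup>2) +
              cmod (deriv \<psi> z) * (1 - (cmod z)\<^sup>2) / (1 - (cmod (\<psi> z))\<^sup>2)))
          \<longlongrightarrow> 0) to_unit_circle"
proof -
  let ?T = "composition_operator \<phi> - composition_operator \<psi>"
  have deriv_T: "deriv (?T f) z = deriv f (\<phi> z) * deriv \<phi> z - deriv f (\<psi> z) * deriv \<psi> z"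
    if f: "f \<in> dirichlet_space" and z: "cmod z < 1" for f z
  proof -
    have \<phi>: "\<phi> field_differentiable at z" "cmod (\<phi> z) < 1"
      and \<psi>: "\<psi> field_differentiable at z" "cmod (\<psi> z) < 1"
      using assms(1,2) z
      by (force simp: analytic_self_map_def intro: holomorphic_on_imp_differentiable_at)+
    have f': "f field_differentiable at w" if "cmod w < 1" for w
      using dirichlet_space_holomorphic[OF f] that
      by (auto intro: holomorphic_on_imp_differentiable_at)
    have "?T f = (\<lambda>z. (f \<circ> \<phi>) z - (f \<circ> \<psi>) z)"
      by (simp add: composition_operator_def fun_eq_iff)
    moreover have "deriv (\<lambda>z. (f \<circ> \<phi>) z - (f \<circ> \<psi>) z) z = deriv (f \<circ> \<phi>) z - deriv (f \<circ> \<psi>) z"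
      using \<phi> \<psi> f' by (intro deriv_diff field_differentiable_compose)
    ultimately have "deriv (?T f) z = deriv (f \<circ> \<phi>) z - deriv (f \<circ> \<psi>) z"
      by simp
    also have "deriv (f \<circ> \<phi>) z = deriv f (\<phi> z) * deriv \<phi> z"
      using \<phi> f' by (intro deriv_chain)
    also have "deriv (f \<circ> \<psi>) z = deriv f (\<psi> z) * deriv \<psi> z"
      using \<psi> f' by (intro deriv_chain)
    finally show ?thesis .
  qed
  \<comment> \<open>For each \<open>z\<close> the test function \<open>F z\<close> is frozen:
    \<open>?T (F z)\<close> is differentiated as a fixed function and only then evaluated at
    \<open>z\<close>. The chain rule rewrites this for \<open>z\<close> in the disc, which suffices
    along the filter.\<close>
  have test: "((\<lambda>z. (1 - (cmod z)\<^sup>2) *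
      cmod (deriv (F z) (\<phi> z) * deriv \<phi> z - deriv (F z) (\<psi> z) * deriv \<psi> z)) \<longlongrightarrow> 0) to_unit_circle"
    if F: "\<And>z. cmod z < 1 \<Longrightarrow> F z \<in> dirichlet_space \<and> dirichlet_norm (F z) \<le> 14" for F
  proof (rule Lim_transform_eventually)
    show "((\<lambda>z. (1 - (cmod z)\<^sup>2) * cmod (deriv (?T (F z)) z)) \<longlongrightarrow> 0) to_unit_circle"
      using F by (intro compact_deriv_tendsto_0[OF assms(5), of _ 14]) auto
    show "\<forall>\<^sub>F z in to_unit_circle. (1 - (cmod z)\<^sup>2) * cmod (deriv (?T (F z)) z) = (1 - (cmod z)\<^sup>2) *
        cmod (deriv (F z) (\<phi> z) * deriv \<phi> z - deriv (F z) (\<psi> z) * deriv \<psi> z)"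
      using eventually_to_unit_circle by eventually_elim (use F deriv_T in auto)
  qed
  \<comment> \<open>The second summand is the first with the maps exchanged; symmetry of the
    pseudohyperbolic distance afterwards merges the two.\<close>
  have "((\<lambda>z. pseudohyp_dist \<phi> \<psi> z * (cmod (deriv \<phi> z) * (1 - (cmod z)\<^sup>2) / (1 - (cmod (\<phi> z))\<^sup>2)) +
      pseudohyp_dist \<psi> \<phi> z * (cmod (deriv \<psi> z) * (1 - (cmod z)\<^sup>2) / (1 - (cmod (\<psi> z))\<^sup>2)))
      \<longlongrightarrow> 0 + 0) to_unit_circle"
  proof (intro tendsto_add pseudohyp_deriv_tendsto_0 assms(1,2))
    fix F :: "complex \<Rightarrow> complex \<Rightarrow> complex"
    assume "\<And>z. cmod z < 1 \<Longrightarrow> F z \<in> dirichlet_space \<and> dirichlet_norm (F z) \<le> 14"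
    note test = test[OF this]
    from test show "((\<lambda>z. (1 - (cmod z)\<^sup>2) *
        cmod (deriv (F z) (\<phi> z) * deriv \<phi> z - deriv (F z) (\<psi> z) * deriv \<psi> z)) \<longlongrightarrow> 0) to_unit_circle" .
    from test show "((\<lambda>z. (1 - (cmod z)\<^sup>2) *
        cmod (deriv (F z) (\<psi> z) * deriv \<psi> z - deriv (F z) (\<phi> z) * deriv \<phi> z)) \<longlongrightarrow> 0) to_unit_circle"
      by (simp only: norm_minus_commute)
  qed
  then show ?thesis
    unfolding pseudohyp_dist_commute[of \<psi> \<phi>] by (simp only: distrib_left add_0)
qed

end
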